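(* Let $m\ge1$, $n\ge1$ and $1\le\ell\le n$. The number $r_{e,\ell}(\mathcal{C}_{n,[m]})$ of regions of level $\ell$ of the $m$-Catalan arrangement $\mathcal{C}_{n,[m]}$ contained in $\{x_1>x_2>\dots>x_n\}$ is \[r_{e,\ell}(\mathcal{C}_{n,[m]})=\frac{m\ell}{(m+1)n-\ell}\binom{(m+1)n-\ell}{mn},\] and the total number of regions of level $\ell$ is $r_\ell(\mathcal{C}_{n,[m]})=n!\,r_{e,\ell}(\mathcal{C}_{n,[m]})$.
   Context: The $m$-Catalan arrangement $\mathcal{C}_{n,[m]}$ is the arrangement in $\mathbb{R}^n$ of hyperplanes $x_i-x_j=0$ ($i<j$) and $x_i-x_j=k$ ($i\ne j$, $1\le k\le m$); for $n=1$ it is empty with unique region $\mathbb{R}$. Regions are connected components of the complement. The level of $X\subseteq\mathbb{R}^n$ is the smallest integer $\ell\ge0$ such that there are a linear subspace $W$ of dimension $\ell$ and $r>0$ with $X\subseteq\{\bm x:\min_{\bm y\in W}\|\bm x-\bm y\|\le r\}$. *)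

theory Defs
  imports "HOL-Analysis.Analysis"
begin

text \<open>R^n is modelled as real^'n with a finite linearly ordered index type 'n,
  n = CARD('n); the order on 'n gives the coordinate order x_1, ..., x_n.\<close>

definition catalan_union :: "nat \<Rightarrow> (real^'n::{finite,linorder}) set" where
  "catalan_union m = {x. \<exists>i j. (i < j \<and> x$i - x$j = 0) \<or>
       (i \<noteq> j \<and> (\<exists>k::nat. 1 \<le> k \<and> k \<le> m \<and> x$i - x$j = real k))}"

definition catalan_regions :: "nat \<Rightarrow> (real^'n::{finite,linorder}) set set" where
  "catalan_regions m = components (UNIV - catalan_union m)"

definition level :: "'a::euclidean_space set \<Rightarrow> nat" where
  "level X = (LEAST l. \<exists>W. subspace W \<and> dim W = l \<and>
       (\<exists>r>0. X \<subseteq> {x. infdist x W \<le> r}))"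

definition dominant_chamber :: "(real^'n::{finite,linorder}) set" where
  "dominant_chamber = {x. \<forall>i j. i < j \<longrightarrow> x$j < x$i}"

end

theory Submission
  imports Defs
begin

text \<open>Two generic points lie in the same region iff the differences of their coordinates compare in
  the same way with \<open>0, \<dots>, m\<close>. Call \<open>j\<close> a block minimum of \<open>x\<close> if every smaller coordinate is smaller
  by more than \<open>m\<close>. The blocks of coordinates between consecutive block minima have bounded diameter
  throughout the region but can be moved apart freely, so the level is the number of blocks.

  For a point with coordinates \<open>X 0 < X 1 < \<dots>\<close>, let \<open>d j\<close> count the pairs \<open>(i, k)\<close>, \<open>i < j\<close>,
  \<open>1 \<le> k \<le> m\<close>, with \<open>X i + k > X j\<close>. The sequence \<open>d\<close> determines the region, the sequences that occur
  are those with \<open>d 0 = 0\<close> and \<open>d (j + 1) \<le> d j + m\<close> (the heights of an \<open>m\<close>-Dyck path before its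
  up-steps), and \<open>d j = 0\<close> iff \<open>j\<close> starts a block. Counting such sequences with \<open>l\<close> zeros gives a Raney
  number. Permuting coordinates reduces arbitrary regions to those in the dominant chamber.\<close>

section \<open>Regions as sign classes\<close>

lemma notin_catalan_union_iff:
  "x \<notin> catalan_union m \<longleftrightarrow> (\<forall>i j. \<forall>k\<le>m. i \<noteq> j \<longrightarrow> x$i - x$j \<noteq> real k)"
proof
  assume x: "x \<notin> catalan_union m"
  show "\<forall>i j. \<forall>k\<le>m. i \<noteq> j \<longrightarrow> x$i - x$j \<noteq> real k"
  proof (intro allI impI notI)
    fix i j k assume k: "k \<le> m" "i \<noteq> j" "x$i - x$j = real k"
    show False
    proof (cases "k = 0")
      case True
      then have "x$i - x$j = 0" "x$j - x$i = 0" using k by auto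
      then show ?thesis using \<open>i \<noteq> j\<close> x unfolding catalan_union_def
        by (metis (mono_tags, lifting) linorder_neqE mem_Collect_eq)
    next
      case False
      then have "1 \<le> k" by simp
      then show ?thesis using k x unfolding catalan_union_def by blast
    qed
  qed
next
  assume *: "\<forall>i j. \<forall>k\<le>m. i \<noteq> j \<longrightarrow> x$i - x$j \<noteq> real k"
  show "x \<notin> catalan_union m"
    unfolding catalan_union_def using *[rule_format, of 0] * by fastforce
qed

lemma notin_catalan_union_inj: "x \<notin> catalan_union m \<Longrightarrow> x$i = x$j \<Longrightarrow> i = j"
  unfolding notin_catalan_union_iff by (metis diff_self le0 of_nat_0)

text \<open>Only thresholds \<open>0..m\<close> are recorded. For generic points a comparison with
  \<open>-k\<close> is the comparison with \<open>k\<close> for the swapped pair, because equality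
  is excluded.\<close>

definition sign_class :: "nat \<Rightarrow> real^'n::{finite,linorder} \<Rightarrow> (real^'n::{finite,linorder}) set" where
  "sign_class m x = {y. y \<notin> catalan_union m \<and>
     (\<forall>i j. \<forall>k\<le>m. real k < x$i - x$j \<longleftrightarrow> real k < y$i - y$j)}"

lemma sign_classD:
  "y \<in> sign_class m x \<Longrightarrow> k \<le> m \<Longrightarrow> real k < x$i - x$j \<longleftrightarrow> real k < y$i - y$j"
  by (auto simp: sign_class_def)

lemma sign_class_self: "x \<notin> catalan_union m \<Longrightarrow> x \<in> sign_class m x"
  by (simp add: sign_class_def)

lemma sign_class_eq: "y \<in> sign_class m x \<Longrightarrow> sign_class m y = sign_class m x"
  by (auto simp: sign_class_def)

lemma sign_class_order: "y \<in> sign_class m x \<Longrightarrow> x$i < x$j \<longleftrightarrow> y$i < y$j"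
  using sign_classD[of y m x 0 j i] by simp

text \<open>Off the hyperplanes "not greater than \<open>k\<close>" means "less than
  \<open>k\<close>", so every condition confines the points to an open half-space.\<close>

lemma convex_sign_class:
  fixes x :: "real^'n::{finite,linorder}"
  shows "convex (sign_class m x)"
proof (rule convexI)
  fix y z :: "(real,'n) vec" and u v :: real
  assume y: "y \<in> sign_class m x" and z: "z \<in> sign_class m x" and uv: "0 \<le> u" "0 \<le> v" "u + v = 1"
  let ?w = "u *\<^sub>R y + v *\<^sub>R z"
  have w: "?w$i - ?w$j = u *\<^sub>R (y$i - y$j) + v *\<^sub>R (z$i - z$j)" for i j
    by (simp add: algebra_simps)
  have gt: "real k < ?w$i - ?w$j" if "k \<le> m" "real k < x$i - x$j" for i j k
    using convexD[OF convex_real_interval(3)[of "real k"] _ _ uv, of "y$i - y$j" "z$i - z$j"]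
      sign_classD[OF y that(1), of i j] sign_classD[OF z that(1), of i j] that
    unfolding w by simp
  have lt: "?w$i - ?w$j < real k" if "k \<le> m" "\<not> real k < x$i - x$j" "i \<noteq> j" for i j k
  proof -
    have "y$i - y$j \<noteq> real k" "z$i - z$j \<noteq> real k"
      using y z that by (auto simp: sign_class_def notin_catalan_union_iff)
    then have "y$i - y$j < real k" "z$i - z$j < real k"
      using sign_classD[OF y that(1), of i j] sign_classD[OF z that(1), of i j] that(2) by auto
    then show ?thesis
      using convexD[OF convex_real_interval(4)[of "real k"] _ _ uv, of "y$i - y$j" "z$i - z$j"]
      unfolding w by simp
  qed
  have "?w \<notin> catalan_union m"
    unfolding notin_catalan_union_iff using gt lt by (metis less_irrefl)
  moreover have "real k < x$i - x$j \<longleftrightarrow> real k < ?w$i - ?w$j" if "k \<le> m" for i j k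
    using gt[OF that, of i j] lt[OF that, of i j]
    by (cases "i = j"; cases "real k < x$i - x$j") (simp_all del: vector_add_component)
  ultimately show "?w \<in> sign_class m x"
    unfolding sign_class_def by blast
qed

text \<open>The class is convex, hence connected. Conversely, on a connected set in the complement
  \<open>x$i - x$j\<close> never takes the value \<open>k\<close>, so by the intermediate value
  property it stays on one side of \<open>k\<close>.\<close>

lemma connected_component_catalan:
  fixes x :: "real^'n::{finite,linorder}"
  assumes x: "x \<notin> catalan_union m"
  shows "connected_component_set (UNIV - catalan_union m) x = sign_class m x"
proof
  show "sign_class m x \<subseteq> connected_component_set (UNIV - catalan_union m) x"
    by (rule connected_component_maximal)
      (auto simp: sign_class_self x convex_connected convex_sign_class, simp add: sign_class_def)
next
  show "connected_component_set (UNIV - catalan_union m) x \<subseteq> sign_class m x"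
  proof
    fix y assume "y \<in> connected_component_set (UNIV - catalan_union m) x"
    then obtain t where t: "connected t" "t \<subseteq> UNIV - catalan_union m" "x \<in> t" "y \<in> t"
      by (auto simp: connected_component_def)
    have "real k < x$i - x$j \<longleftrightarrow> real k < y$i - y$j" if k: "k \<le> m" and "i \<noteq> j" for i j k
    proof -
      let ?f = "\<lambda>z::(real,'n) vec. z$i - z$j"
      have c: "connected (?f ` t)"
        by (intro connected_continuous_image continuous_intros t)
      have "real k \<notin> ?f ` t"
      proof
        assume "real k \<in> ?f ` t"
        then obtain z where "z \<in> t" "z$i - z$j = real k" by auto
        moreover have "z \<notin> catalan_union m" using t(2) \<open>z \<in> t\<close> by auto
        ultimately show False using that unfolding notin_catalan_union_iff by blast
      qed
      then show ?thesis
        using connectedD_interval[OF c, of "?f x" "?f y" "real k"]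
          connectedD_interval[OF c, of "?f y" "?f x" "real k"] t(3,4)
        by (smt (verit) imageI)
    qed
    then have "real k < x$i - x$j \<longleftrightarrow> real k < y$i - y$j" if "k \<le> m" for i j k
      using that by (cases "i = j") auto
    then show "y \<in> sign_class m x" using t by (auto simp: sign_class_def)
  qed
qed

lemma catalan_regions_eq: "catalan_regions m = sign_class m ` (- catalan_union m)"
  unfolding catalan_regions_def components_def
  by (auto simp: connected_component_catalan image_iff)

section \<open>The level of a region\<close>

definition block_minima :: "nat \<Rightarrow> real^'n::finite \<Rightarrow> 'n set" where
  "block_minima m x = {j. \<forall>i. x$i < x$j \<longrightarrow> real m < x$j - x$i}"

text \<open>Along \<open>v\<close> a positive difference never shrinks, and it moves only if it
  already exceeds \<open>m\<close>; a negative one stays negative. Hence no hyperplane is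
  crossed.\<close>

lemma recession_direction:
  fixes x :: "real^'n::{finite,linorder}"
  assumes x: "x \<notin> catalan_union m" and "0 \<le> t"
    and v: "\<And>i j. x$j < x$i \<Longrightarrow> v$j \<le> v$i \<and> (v$j = v$i \<or> real m < x$i - x$j)"
  shows "x + t *\<^sub>R v \<in> sign_class m x"
proof -
  let ?y = "x + t *\<^sub>R v"
  have *: "?y$i - ?y$j \<noteq> real k \<and> (real k < x$i - x$j \<longleftrightarrow> real k < ?y$i - ?y$j)"
    if k: "k \<le> m" and "i \<noteq> j" for i j k
  proof -
    have ne: "x$i - x$j \<noteq> real k" using x that by (auto simp: notin_catalan_union_iff)
    have d: "?y$i - ?y$j = (x$i - x$j) + t * (v$i - v$j)" by (simp add: algebra_simps)
    consider "x$i < x$j" | "x$j < x$i"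
      using notin_catalan_union_inj[OF x] \<open>i \<noteq> j\<close> by (meson linorder_neqE_linordered_idom)
    then show ?thesis
    proof cases
      case 1
      then have "t * (v$i - v$j) \<le> 0"
        using v[OF 1] \<open>0 \<le> t\<close> by (simp add: mult_nonneg_nonpos)
      then show ?thesis unfolding d using 1 by (smt (verit) of_nat_0_le_iff)
    next
      case 2
      then have "t * (v$i - v$j) \<ge> 0" using v[OF 2] \<open>0 \<le> t\<close> by simp
      moreover have "v$j = v$i \<or> real k < x$i - x$j" using v[OF 2] k by auto
      ultimately show ?thesis unfolding d using ne by auto
    qed
  qed
  have "?y \<notin> catalan_union m" unfolding notin_catalan_union_iff using * by blast
  moreover have "real k < x$i - x$j \<longleftrightarrow> real k < ?y$i - ?y$j" if "k \<le> m" for i j k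
    using *[OF that, of i j] by (cases "i = j") auto
  ultimately show ?thesis unfolding sign_class_def by blast
qed

text \<open>If \<open>v\<close> had distance \<delta> > 0 from \<open>W\<close>, the distance of
  \<open>x + t *\<^sub>R v\<close> from \<open>W\<close> would be at least
  \<open>t * \<delta> - norm x\<close>, which is unbounded.\<close>

lemma ray_in_subspace:
  fixes v x :: "'a::euclidean_space"
  assumes W: "subspace W" and r: "\<And>t. 0 \<le> t \<Longrightarrow> infdist (x + t *\<^sub>R v) W \<le> r"
  shows "v \<in> W"
proof (rule ccontr)
  assume "v \<notin> W"
  have cl: "closed W" and ne: "W \<noteq> {}" using W closed_subspace subspace_0 by blast+
  define \<delta> where "\<delta> = infdist v W"
  have \<delta>: "\<delta> > 0"
    using \<open>v \<notin> W\<close> in_closed_iff_infdist_zero[OF cl ne, of v] infdist_nonneg[of v W]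
    by (simp add: \<delta>_def)
  have r0: "0 \<le> r" using r[of 0] infdist_nonneg[of x W] by simp
  \<comment> \<open>Chosen so that \<open>t * \<delta>\<close> exceeds \<open>r + norm x\<close> by
    one.\<close>
  define t where "t = (r + norm x + 1) / \<delta>"
  have t: "t > 0" using \<delta> r0 by (simp add: t_def add_nonneg_pos)
  obtain w where w: "w \<in> W" "infdist (x + t *\<^sub>R v) W = dist (x + t *\<^sub>R v) w"
    using infdist_attains_inf[OF cl ne] by blast
  have "(1/t) *\<^sub>R w \<in> W" using W w by (simp add: subspace_scale)
  then have "\<delta> \<le> dist v ((1/t) *\<^sub>R w)" unfolding \<delta>_def by (rule infdist_le)
  then have "t * \<delta> \<le> t * dist v ((1/t) *\<^sub>R w)" using t by simp
  also have "\<dots> = norm (t *\<^sub>R (v - (1/t) *\<^sub>R w))" using t by (simp add: dist_norm)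
  also have "\<dots> = norm ((x + t *\<^sub>R v - w) - x)" using t by (simp add: algebra_simps)
  also have "\<dots> \<le> norm (x + t *\<^sub>R v - w) + norm x" by (rule norm_triangle_ineq4)
  also have "\<dots> \<le> r + norm x" using r[of t] w t by (simp add: dist_norm)
  finally show False using \<delta> by (simp add: t_def)
qed

text \<open>The indicator vectors of the blocks span a space of dimension \<open>card ?T\<close>.
  The region stays within bounded distance of it, and every admissible \<open>W\<close> must contain
  all the indicators.\<close>

lemma level_sign_class:
  fixes x :: "real^'n::{finite,linorder}"
  assumes x: "x \<notin> catalan_union m"
  shows "level (sign_class m x) = card (block_minima m x)"
proof -
  let ?T = "block_minima m x"
  have inj: "x$i = x$j \<Longrightarrow> i = j" for i j using notin_catalan_union_inj[OF x] .
  have argmax: "\<exists>j\<in>S. \<forall>k\<in>S. f k \<le> f j" if "S \<noteq> {}" for S :: "'n set" and f :: "'n \<Rightarrow> real"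
    using Max_in[of "f ` S"] Max_ge[of "f ` S"] that by fastforce
  \<comment> \<open>The witness \<open>b i\<close> is the minimum of the block of \<open>i\<close>:
    the largest block minimum not exceeding \<open>x$i\<close>. One exists because the least
    coordinate of all is a block minimum.\<close>
  have "\<exists>j. j \<in> ?T \<and> x$j \<le> x$i \<and> (\<forall>k\<in>?T. x$k \<le> x$i \<longrightarrow> x$k \<le> x$j)" for i
  proof -
    obtain b where b: "\<forall>k. x$b \<le> x$k"
      using argmax[of UNIV "\<lambda>k. - x$k"] by auto
    then have "b \<in> {j \<in> ?T. x$j \<le> x$i}" by (auto simp: block_minima_def not_less[symmetric])
    then show ?thesis using argmax[of "{j \<in> ?T. x$j \<le> x$i}" "\<lambda>k. x$k"] by blast
  qed
  then obtain b where b: "\<And>i. b i \<in> ?T" "\<And>i. x$(b i) \<le> x$i"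
      "\<And>i k. k \<in> ?T \<Longrightarrow> x$k \<le> x$i \<Longrightarrow> x$k \<le> x$(b i)"
    by metis
  have bT: "b j = j" if "j \<in> ?T" for j
    using b(2)[of j] b(3)[OF that, of j] inj by force
  \<comment> \<open>Such a direction is constant on blocks and does not decrease from lower to
    higher blocks, and coordinates of different blocks differ by more than \<open>m\<close>.\<close>
  have rec: "x + t *\<^sub>R (\<chi> i. \<phi> (x$(b i))) \<in> sign_class m x" if "mono \<phi>" "0 \<le> t" for \<phi> t
  proof (rule recession_direction[OF x \<open>0 \<le> t\<close>])
    fix i j assume ji: "x$j < x$i"
    then have le: "x$(b j) \<le> x$(b i)" using b(1,2)[of j] b(3)[of "b j" i] by simp
    have "real m < x$i - x$j" if "x$(b j) \<noteq> x$(b i)"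
    proof -
      have "x$j < x$(b i)" using that le b(3)[of "b i" j] b(1) by force
      then have "real m < x$(b i) - x$j" using b(1)[of i] by (simp add: block_minima_def)
      then show ?thesis using b(2)[of i] by simp
    qed
    then show "(\<chi> i. \<phi> (x$(b i)))$j \<le> (\<chi> i. \<phi> (x$(b i)))$i \<and>
       ((\<chi> i. \<phi> (x$(b i)))$j = (\<chi> i. \<phi> (x$(b i)))$i \<or> real m < x$i - x$j)"
      using monoD[OF \<open>mono \<phi>\<close> le] by (cases "x$(b j) = x$(b i)") auto
  qed
  define e :: "'n \<Rightarrow> (real,'n) vec" where "e = (\<lambda>j. \<chi> i. if b i = j then 1 else 0)"
  have ecomp: "e j $ i = (if b i = j then 1 else 0)" for i j by (simp add: e_def)
  have einj: "inj_on e ?T"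
  proof (rule inj_onI)
    fix j k assume "j \<in> ?T" "k \<in> ?T" "e j = e k"
    then show "j = k" using ecomp[of j j] ecomp[of k j] bT by (metis zero_neq_one)
  qed
  have "pairwise orthogonal (e ` ?T)"
    by (auto simp: pairwise_def orthogonal_def inner_vec_def ecomp intro!: sum.neutral)
  moreover have "0 \<notin> e ` ?T"
  proof
    assume "0 \<in> e ` ?T"
    then obtain j where "j \<in> ?T" "e j = 0" by auto
    then show False using ecomp[of j j] bT by simp
  qed
  ultimately have ind: "independent (e ` ?T)" by (rule pairwise_orthogonal_independent)
  have dimW: "dim (span (e ` ?T)) = card ?T"
    using dim_span_eq_card_independent[OF ind] card_image[OF einj] by simp
  \<comment> \<open>A coordinate that is not a block minimum has a smaller one within
    \<open>m\<close>, necessarily in the same block. Descending to \<open>b i\<close> thus costs at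
    most \<open>m\<close> per step, and the number of steps depends on \<open>x\<close> only, not on
    \<open>y\<close>.\<close>
  have bound: "y$i - y$(b i) \<le> real m * real (card {k. x$k < x$i})" if y: "y \<in> sign_class m x" for y i
  proof (induction "card {k. x$k < x$i}" arbitrary: i rule: less_induct)
    case less
    show ?case
    proof (cases "i \<in> ?T")
      case True
      then show ?thesis by (simp add: bT)
    next
      case False
      then obtain k where k: "x$k < x$i" "x$i - x$k \<le> real m"
        by (auto simp: block_minima_def not_less)
      have "x$(b i) \<le> x$k"
        using b(1)[of i, unfolded block_minima_def, THEN CollectD, THEN spec, of k] b(2)[of i] k
        by linarith
      then have "b k = b i"
        using b(1,2)[of k] b(3)[of "b i" k] b(3)[of "b k" i] b(1)[of i] k inj
        by (meson dual_order.antisym less_imp_le order_trans)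
      have c: "card {l. x$l < x$k} < card {l. x$l < x$i}"
        by (rule psubset_card_mono) (use k in auto)
      have "y$i - y$k \<le> real m" using sign_classD[OF y order_refl, of i k] k by simp
      then have "y$i - y$(b i) \<le> real m + real m * real (card {l. x$l < x$k})"
        using less[OF c] \<open>b k = b i\<close> by simp
      also have "\<dots> = real m * real (Suc (card {l. x$l < x$k}))" by (simp add: algebra_simps)
      also have "\<dots> \<le> real m * real (card {l. x$l < x$i})"
        using c by (intro mult_left_mono) auto
      finally show ?thesis .
    qed
  qed
  \<comment> \<open>The coordinatewise bounds are added up because the distance is estimated by the
    l1 norm; the extra 1 keeps \<open>r\<close> positive when the sum vanishes.\<close>
  define r where "r = (\<Sum>i\<in>(UNIV::'n set). real m * real (card {k. x$k < x$i})) + 1"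
  have "0 < r" unfolding r_def by (intro add_nonneg_pos sum_nonneg) auto
  have near: "infdist y (span (e ` ?T)) \<le> r" if y: "y \<in> sign_class m x" for y
  proof -
    define w where "w = (\<Sum>j\<in>?T. y$j *\<^sub>R e j)"
    have "w \<in> span (e ` ?T)" unfolding w_def by (intro span_sum span_scale span_base) auto
    then have "infdist y (span (e ` ?T)) \<le> norm (y - w)" unfolding dist_norm[symmetric] by (rule infdist_le)
    also have "\<dots> \<le> (\<Sum>i\<in>UNIV. \<bar>(y - w)$i\<bar>)" by (rule norm_le_l1_cart)
    also have "\<dots> \<le> (\<Sum>i\<in>UNIV. real m * real (card {k. x$k < x$i}))"
    proof (rule sum_mono)
      fix i
      have "w$i = (\<Sum>j\<in>?T. if j = b i then y$j else 0)"
        unfolding w_def sum_component by (intro sum.cong) (auto simp: ecomp)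
      then have "w$i = y$(b i)" using b(1)[of i] by simp
      moreover have "y$(b i) \<le> y$i"
        using b(2)[of i] sign_class_order[OF y, of i "b i"] by simp
      ultimately show "\<bar>(y - w)$i\<bar> \<le> real m * real (card {k. x$k < x$i})"
        using bound[OF y, of i] by simp
    qed
    finally show ?thesis by (simp add: r_def)
  qed
  show ?thesis unfolding level_def
  proof (rule Least_equality)
    show "\<exists>W. subspace W \<and> dim W = card ?T \<and> (\<exists>r>0. sign_class m x \<subseteq> {x. infdist x W \<le> r})"
      using dimW near \<open>0 < r\<close> by (intro exI[of _ "span (e ` ?T)"]) auto
  next
    fix l assume "\<exists>W::(real,'n) vec set. subspace W \<and> dim W = l \<and> (\<exists>r>0. sign_class m x \<subseteq> {x. infdist x W \<le> r})"
    then obtain W s where W: "subspace W" "dim W = l" "sign_class m x \<subseteq> {x. infdist x W \<le> s}"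
      by auto
    have dir: "(\<chi> i. \<phi> (x$(b i))) \<in> W" if "mono \<phi>" for \<phi>
      using rec[OF that] W(3) by (intro ray_in_subspace[OF W(1), of x _ s]) auto
    have "e j \<in> W" if "j \<in> ?T" for j
    proof -
      \<comment> \<open>The indicator of a single block need not come from a monotone function, but
        it is the difference of two monotone step functions of the block minimum.\<close>
      have "(\<chi> i. of_bool (x$j \<le> x$(b i))) - (\<chi> i. of_bool (x$j < x$(b i))) \<in> W"
        by (intro subspace_diff[OF W(1)] dir[of "\<lambda>s. of_bool (x$j \<le> s)"] dir[of "\<lambda>s. of_bool (x$j < s)"])
          (auto simp: mono_def)
      moreover have "(\<chi> i. of_bool (x$j \<le> x$(b i))) - (\<chi> i. of_bool (x$j < x$(b i))) = e j"
        using inj by (auto simp: vec_eq_iff ecomp order_le_less)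
      ultimately show ?thesis by simp
    qed
    then have "card (e ` ?T) \<le> dim W" by (intro independent_card_le_dim ind) auto
    then show "card ?T \<le> l" using card_image[OF einj] W by simp
  qed
qed

section \<open>Counting height sequences\<close>

text \<open>The parameter \<open>h\<close> caps the first entry, so that the tail after
  \<open>d\<close> is again of this kind with cap \<open>d + m\<close>; \<open>h = 0\<close> gives
  the sequences wanted.\<close>

fun height_path :: "nat \<Rightarrow> nat \<Rightarrow> nat list \<Rightarrow> bool" where
  "height_path m h [] \<longleftrightarrow> True"
| "height_path m h (d # ds) \<longleftrightarrow> d \<le> h \<and> height_path m (d + m) ds"

lemma height_path_append:
  "height_path m h (ds @ [d]) \<longleftrightarrow>
     height_path m h ds \<and> d \<le> (if ds = [] then h else last ds + m)"
  by (induction ds arbitrary: h) auto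

definition height_paths :: "nat \<Rightarrow> nat \<Rightarrow> nat \<Rightarrow> nat \<Rightarrow> nat list set" where
  "height_paths m a h l = {ds. length ds = a \<and> height_path m h ds \<and> length (filter ((=) 0) ds) = l}"

lemma height_paths_0: "height_paths m 0 h l = (if l = 0 then {[]} else {})"
  by (auto simp: height_paths_def)

lemma height_paths_Suc_0:
  "height_paths m (Suc a) 0 l = (case l of 0 \<Rightarrow> {} | Suc l' \<Rightarrow> (#) 0 ` height_paths m a m l')"
  by (auto simp: height_paths_def length_Suc_conv split: nat.splits)

text \<open>Either the first entry stays below the cap, or it equals \<open>Suc h\<close>; being
  nonzero, it then leaves the number of zeros to the tail.\<close>

lemma height_paths_Suc_Suc:
  "height_paths m (Suc a) (Suc h) l =
     height_paths m (Suc a) h l \<union> (#) (Suc h) ` height_paths m a (Suc h + m) l"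
  by (auto simp: height_paths_def length_Suc_conv le_Suc_eq)

lemma height_paths_Suc_disjoint:
  "height_paths m (Suc a) h l \<inter> (#) (Suc h) ` A = {}"
  by (auto simp: height_paths_def)

lemma finite_height_paths: "finite (height_paths m a h l)"
proof (induction a arbitrary: h l)
  case 0
  then show ?case by (simp add: height_paths_0)
next
  case (Suc a)
  note IH = Suc
  show ?case
  proof (induction h)
    case 0
    then show ?case by (auto simp: height_paths_Suc_0 IH split: nat.splits)
  next
    case (Suc h)
    then show ?case by (simp add: height_paths_Suc_Suc IH)
  qed
qed

text \<open>The Raney number \<open>p / ((m+1) k + p) * ((m+1) k + p choose k)\<close>, written
  as a difference of binomial coefficients so that no division by zero occurs at \<open>p = k = 0\<close>.\<close>
definition raney :: "nat \<Rightarrow> nat \<Rightarrow> nat \<Rightarrow> int" where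
  "raney m p k = (case k of 0 \<Rightarrow> 1
     | Suc k' \<Rightarrow> int (((m + 1) * k + p - 1) choose k) - int m * int (((m + 1) * k + p - 1) choose k'))"

text \<open>Multiply by \<open>(m + 1) * k + p\<close> and apply Pascal's rule and the absorption
  identity; the factor left over is \<open>p\<close>.\<close>

lemma raney_closed_form:
  assumes "p \<ge> 1"
  shows "real_of_int (raney m p k) =
     real p / real ((m + 1) * k + p) * real (((m + 1) * k + p) choose k)"
proof (cases k)
  case 0
  then show ?thesis using assms by (simp add: raney_def)
next
  case (Suc k')
  define N where "N = (m + 1) * k + p - 1"
  have N: "(m + 1) * k + p = Suc N" "N \<ge> k'" "real N = real m * real k + real k + real p - 1"
    using assms Suc by (auto simp: N_def of_nat_diff algebra_simps)
  have a: "real (Suc k') * real (Suc N choose Suc k') = real (Suc N) * real (N choose k')"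
    using Suc_times_binomial_eq[of N k'] by (metis of_nat_mult mult.commute)
  have b: "real (Suc N choose Suc k') = real (N choose k') + real (N choose Suc k')" by simp
  have "real (Suc N) * real_of_int (raney m p k) = real p * real (Suc N choose k)"
  proof -
    have "real (Suc N) * real_of_int (raney m p k)
        = real (Suc N) * (real (Suc N choose Suc k') - real (m + 1) * real (N choose k'))"
      unfolding raney_def N_def[symmetric] by (simp add: Suc algebra_simps)
    also have "\<dots> = real (Suc N) * real (Suc N choose Suc k')
         - real (m + 1) * (real (Suc k') * real (Suc N choose Suc k'))"
      unfolding a by (simp only: algebra_simps)
    also have "\<dots> = (real (Suc N) - real (m + 1) * real k) * real (Suc N choose k)"
      unfolding Suc by (simp only: algebra_simps)
    also have "real (Suc N) - real (m + 1) * real k = real p"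
      using N by (simp add: algebra_simps)
    finally show ?thesis .
  qed
  then show ?thesis unfolding N(1) by (simp add: field_simps del: binomial_Suc_Suc)
qed

text \<open>Boundary value for nonempty sequences with cap 0 and no zeros, of which there are none.
  By absorption the two binomial terms cancel.\<close>

lemma raney_0: "raney m 0 (Suc k) = 0"
proof -
  define N where "N = (m + 1) * Suc k - 1"
  have N: "Suc N = (m + 1) * Suc k" by (simp add: N_def)
  have "Suc k * (Suc N choose Suc k) = Suc N * (N choose k)"
    using Suc_times_binomial_eq[of N k] by simp
  then have "Suc k * (Suc N choose Suc k) = Suc k * ((m + 1) * (N choose k))"
    unfolding N by (simp only: ac_simps)
  then have "Suc N choose Suc k = (m + 1) * (N choose k)" by (simp only: mult_cancel1) auto
  then have "N choose Suc k = m * (N choose k)" by simp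
  then show ?thesis by (simp add: raney_def N_def)
qed

text \<open>Pascal's rule in both binomial terms. The recurrence mirrors
  \<open>height_paths_Suc_Suc\<close>: lower the cap by one, or use up an entry and raise the cap by
  \<open>m\<close>.\<close>

lemma raney_Suc: "raney m (Suc p) (Suc k) = raney m p (Suc k) + raney m (Suc p + m) k"
proof -
  define N where "N = (m + 1) * Suc k + p - 1"
  have N: "(m + 1) * Suc k + p = Suc N" by (simp add: N_def)
  have l: "raney m (Suc p) (Suc k) = int (Suc N choose Suc k) - int m * int (Suc N choose k)"
    unfolding raney_def N[symmetric] by simp
  have r: "raney m p (Suc k) = int (N choose Suc k) - int m * int (N choose k)"
    unfolding raney_def N_def by simp
  show ?thesis
  \<comment> \<open>At index 0 the Raney number is 1 by definition and has no second binomial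
    term.\<close>
  proof (cases k)
    case 0
    then show ?thesis unfolding l r by (simp add: raney_def)
  next
    case (Suc k')
    have "(m + 1) * k + (Suc p + m) - 1 = N" unfolding N_def by simp
    then have "raney m (Suc p + m) k = int (N choose k) - int m * int (N choose k')"
      unfolding raney_def Suc by simp
    then show ?thesis unfolding l r unfolding Suc by (simp add: algebra_simps)
  qed
qed

text \<open>Both sides obey the same recurrence in length and cap. Each prescribed zero adds
  \<open>m\<close> to the parameter: removing a forced leading 0 turns cap 0 with
  \<open>Suc l'\<close> zeros into cap \<open>m\<close> with \<open>l'\<close> zeros.\<close>

lemma card_height_paths:
  "int (card (height_paths m a h l)) = (if l \<le> a then raney m (h + m * l) (a - l) else 0)"
proof (induction a arbitrary: h l)
  case 0
  then show ?case by (simp add: height_paths_0 raney_def)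
next
  case (Suc a)
  note IH = Suc
  show ?case
  proof (induction h)
    case 0
    show ?case
    proof (cases l)
      case 0
      then show ?thesis by (simp add: height_paths_Suc_0 raney_0)
    next
      case (Suc l')
      then show ?thesis by (simp add: height_paths_Suc_0 card_image IH)
    qed
  next
    case (Suc h)
    have "int (card (height_paths m (Suc a) (Suc h) l)) =
        int (card (height_paths m (Suc a) h l)) + int (card (height_paths m a (Suc h + m) l))"
      unfolding height_paths_Suc_Suc
      by (subst card_Un_disjoint)
        (auto simp: finite_height_paths height_paths_Suc_disjoint card_image)
    also have "\<dots> = (if l \<le> Suc a then raney m (Suc h + m * l) (Suc a - l) else 0)"
      unfolding Suc IH
      using raney_Suc[of m "h + m * l" "a - l"]
      by (auto simp: Suc_diff_le le_Suc_eq raney_def[of _ _ 0] add_ac)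
    finally show ?case .
  qed
qed

section \<open>Height sequences of generic increasing sequences\<close>

text \<open>In an increasing sequence \<open>X j = X i + k\<close> with \<open>k\<close> positive is
  possible only for \<open>i < j\<close>, so these equalities are the only ones to exclude.\<close>

definition generic_seq :: "nat \<Rightarrow> nat \<Rightarrow> (nat \<Rightarrow> real) \<Rightarrow> bool" where
  "generic_seq m n X \<longleftrightarrow> (\<forall>j<n. \<forall>i<j. X i < X j \<and> (\<forall>k\<in>{1..m}. X j \<noteq> X i + real k))"

definition above :: "nat \<Rightarrow> (nat \<Rightarrow> real) \<Rightarrow> nat \<Rightarrow> (nat \<times> nat) set" where
  "above m X j = {(i, k). i < j \<and> k \<in> {1..m} \<and> X j < X i + real k}"

lemma finite_above: "finite (above m X j)"
  by (rule finite_subset[of _ "{..<j} \<times> {1..m}"]) (auto simp: above_def)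

text \<open>The sets \<open>above m X j\<close> and \<open>above m Y j\<close> are upward closed in the order of the values
  \<open>X i + k\<close>, \<open>i < j\<close>, which by induction agrees with the order of the values \<open>Y i + k\<close>;
  hence they are comparable, and equal as soon as their cardinalities agree.\<close>
lemma above_eq_if_card_eq:
  assumes X: "generic_seq m n X" and Y: "generic_seq m n Y"
    and D: "\<And>j. j < n \<Longrightarrow> card (above m X j) = card (above m Y j)" and "j < n"
  shows "above m X j = above m Y j"
  using \<open>j < n\<close>
proof (induction j rule: less_induct)
  case (less j)
  \<comment> \<open>For \<open>b < a\<close> this is membership of \<open>(b, c)\<close> in the set
    at the earlier position \<open>a\<close>, known by induction; otherwise both inequalities hold
    automatically.\<close>
  have lt: "X a < X b + real c \<longleftrightarrow> Y a < Y b + real c"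
    if "a < j" "b < j" "c \<in> {1..m}" for a b c
  proof (cases "b < a")
    case True
    then have "(b, c) \<in> above m X a \<longleftrightarrow> (b, c) \<in> above m Y a" using less that by auto
    then show ?thesis using True that by (simp add: above_def)
  next
    case False
    then have "X a \<le> X b" "Y a \<le> Y b" using X Y that less.prems
      by (auto simp: generic_seq_def not_less le_less)
    then show ?thesis using that by (auto intro: add_le_less_mono[of _ _ 0, simplified])
  qed
  have lt0: "X a < X b \<longleftrightarrow> Y a < Y b" if "a < j" "b < j" for a b
  proof -
    have "Z a < Z b \<longleftrightarrow> a < b" if Z: "generic_seq m n Z" for Z
    proof -
      have "a < b \<Longrightarrow> Z a < Z b" "b < a \<Longrightarrow> Z b < Z a"
        using Z \<open>a < j\<close> \<open>b < j\<close> less.prems by (auto simp: generic_seq_def)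
      then show ?thesis by (cases a b rule: linorder_cases) auto
    qed
    then show ?thesis using X Y by simp
  qed
  have ne: "X a \<noteq> X b + real c" "Y a \<noteq> Y b + real c" if "a < j" "b < j" "c \<in> {1..m}" for a b c
  proof -
    have "Z a \<noteq> Z b + real c" if Z: "generic_seq m n Z" for Z
    proof (cases "b < a")
      case True
      then show ?thesis using Z \<open>a < j\<close> \<open>c \<in> {1..m}\<close> less.prems by (simp add: generic_seq_def)
    next
      case False
      then have "Z a \<le> Z b" using Z \<open>b < j\<close> less.prems
        by (auto simp: generic_seq_def not_less le_less)
      then show ?thesis using \<open>c \<in> {1..m}\<close> by auto
    qed
    then show "X a \<noteq> X b + real c" "Y a \<noteq> Y b + real c" using X Y by auto
  qed
  \<comment> \<open>Cancelling the smaller shift leaves one shift by the difference of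
    \<open>c\<close> and \<open>d\<close>, which is again at most \<open>m\<close>.\<close>
  have order: "X a + real c < X b + real d \<longleftrightarrow> Y a + real c < Y b + real d"
    if "a < j" "b < j" "c \<in> {1..m}" "d \<in> {1..m}" for a b c d
  proof -
    consider "c < d" | "c = d" | "d < c" by linarith
    then show ?thesis
    proof cases
      case 1
      then have "d - c \<in> {1..m}" using that by auto
      then show ?thesis using lt[OF that(1,2), of "d - c"] 1 by (simp add: of_nat_diff algebra_simps)
    next
      case 2
      then show ?thesis using lt0 that by simp
    next
      case 3
      then have "c - d \<in> {1..m}" using that by auto
      then show ?thesis using lt[OF that(2,1), of "c - d"] ne[OF that(2,1), of "c - d"] 3
        by (simp add: of_nat_diff algebra_simps) argo
    qed
  qed
  \<comment> \<open>Incomparability would give \<open>X b + d \<le> X j < X a + c\<close> but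
    \<open>Y a + c \<le> Y j < Y b + d\<close>, contradicting the common order.\<close>
  have "above m X j \<subseteq> above m Y j \<or> above m Y j \<subseteq> above m X j"
  proof (rule ccontr)
    assume "\<not> ?thesis"
    then obtain a c b d where "(a, c) \<in> above m X j" "(a, c) \<notin> above m Y j"
        "(b, d) \<in> above m Y j" "(b, d) \<notin> above m X j"
      by auto
    then show False using order[of a b c d] order[of b a d c] by (auto simp: above_def)
  qed
  then show ?case using D[OF less.prems] card_subset_eq finite_above by metis
qed

text \<open>Passing from \<open>X k\<close> to the larger next value, old pairs can only drop out,
  and the only new ones are the \<open>m\<close> pairs starting with \<open>k\<close>.\<close>

lemma height_path_of_seq:
  assumes "generic_seq m n X"
  shows "height_path m 0 (map (\<lambda>j. card (above m X j)) [0..<n])"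
  using assms
proof (induction n)
  case 0
  then show ?case by simp
next
  case (Suc n)
  have gen: "generic_seq m n X" using Suc.prems by (auto simp: generic_seq_def)
  show ?case
  proof (cases n)
    case 0
    then show ?thesis by (simp add: above_def)
  next
    case (Suc k)
    have "X k < X n" using Suc.prems Suc by (simp add: generic_seq_def)
    then have "above m X n \<subseteq> above m X k \<union> {k} \<times> {1..m}"
      using Suc by (auto simp: above_def less_Suc_eq)
    then have "card (above m X n) \<le> card (above m X k \<union> {k} \<times> {1..m})"
      by (intro card_mono) (auto simp: finite_above)
    also have "\<dots> \<le> card (above m X k) + m"
      using card_Un_le[of "above m X k" "{k} \<times> {1..m}"] by simp
    finally have "card (above m X n) \<le> card (above m X k) + m" .
    moreover have "last (map (\<lambda>j. card (above m X j)) [0..<n]) = card (above m X k)"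
      "map (\<lambda>j. card (above m X j)) [0..<n] \<noteq> []"
      using Suc by auto
    ultimately have "height_path m 0 (map (\<lambda>j. card (above m X j)) [0..<n] @ [card (above m X n)])"
      using Suc.IH[OF gen] by (simp only: height_path_append if_False simp_thms)
    then show ?thesis by simp
  qed
qed

section \<open>Realising every height sequence by a generic sequence\<close>

lemma exists_gap_above:
  fixes a :: real
  assumes "finite V"
  shows "\<exists>y>a. \<forall>v\<in>V. a < v \<longrightarrow> y < v"
  using assms
proof (induction V)
  case empty
  then show ?case using gt_ex by auto
next
  case (insert v V)
  then obtain y where y: "y > a" "\<forall>v\<in>V. a < v \<longrightarrow> y < v" by auto
  show ?case
  proof (cases "a < v")
    case True
    obtain z where "a < z" "z < min y v" using dense[of a "min y v"] True y by auto
    then show ?thesis using y by (intro exI[of _ z]) auto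
  next
    case False
    then show ?thesis using y by (intro exI[of _ y]) auto
  qed
qed

text \<open>Start just to the right of \<open>a\<close> and move right past one value of
  \<open>V\<close> at a time; each passage lowers the count by exactly one.\<close>

lemma exists_point_with_card_above:
  fixes a :: real
  assumes V: "finite V" and d: "d \<le> card {v\<in>V. a < v}"
  shows "\<exists>y>a. y \<notin> V \<and> card {v\<in>V. y < v} = d"
  using d
proof (induction d rule: inc_induct)
  case base
  obtain y where y: "y > a" "\<forall>v\<in>V. a < v \<longrightarrow> y < v" using exists_gap_above[OF V] by blast
  then have "{v\<in>V. y < v} = {v\<in>V. a < v}" by auto
  then show ?case using y by (intro exI[of _ y]) auto
next
  case (step d)
  then obtain y where y: "y > a" "card {v\<in>V. y < v} = Suc d" by blast
  let ?S = "{v\<in>V. y < v}"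
  have S: "finite ?S" "?S \<noteq> {}" using V y by (auto simp: card_gt_0_iff[symmetric] simp del: Collect_empty_eq)
  define w where "w = Min ?S"
  have w: "w \<in> ?S" "\<And>v. v \<in> ?S \<Longrightarrow> w \<le> v" using Min_in[OF S] Min_le[OF S(1)] unfolding w_def by blast+
  obtain z where z: "z > w" "\<forall>v\<in>V. w < v \<longrightarrow> z < v" using exists_gap_above[OF V] by blast
  have "{v\<in>V. z < v} = ?S - {w}" using z w by force
  then have "card {v\<in>V. z < v} = d" using y w S by simp
  then show ?case using z w y by (intro exI[of _ z]) auto
qed

lemma above_cong: "(\<And>i. i \<le> j \<Longrightarrow> X i = Y i) \<Longrightarrow> above m X j = above m Y j"
  by (auto simp: above_def)

text \<open>The sequence is built term by term: the new last value is placed so that exactly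
  \<open>d\<close> of the values \<open>X i + k\<close> lie above it.\<close>

lemma exists_seq_of_height_path:
  assumes "height_path m 0 ds"
  shows "\<exists>X. generic_seq m (length ds) X \<and> map (\<lambda>j. card (above m X j)) [0..<length ds] = ds"
  using assms
proof (induction ds rule: rev_induct)
  case Nil
  then show ?case by (auto simp: generic_seq_def)
next
  case (snoc d ds)
  define n where "n = length ds"
  from snoc obtain X where X: "generic_seq m n X"
      and D: "map (\<lambda>j. card (above m X j)) [0..<n] = ds"
    by (auto simp: height_path_append n_def)
  let ?P = "{..<n} \<times> {1..m}"
  let ?f = "\<lambda>(i, k). X i + real k"
  \<comment> \<open>Genericity makes the values \<open>X i + k\<close> distinct, so counting values
    is the same as counting pairs.\<close>
  have inj: "inj_on ?f ?P"
  proof (rule inj_onI, clarify)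
    fix i k i' k' assume *: "i < n" "i' < n" "k \<in> {1..m}" "k' \<in> {1..m}" "X i + real k = X i' + real k'"
    have "\<not> i < i'" if "i < n" "i' < n" "k \<in> {1..m}" "k' \<in> {1..m}" "X i + real k = X i' + real k'"
      for i k i' k'
    proof
      assume "i < i'"
      then have "X i < X i'" using X that by (simp add: generic_seq_def)
      then have "k' < k" using that by simp
      then have "X i' = X i + real (k - k')" "k - k' \<in> {1..m}" using that by (auto simp: of_nat_diff)
      then show False using X \<open>i < i'\<close> \<open>i' < n\<close> unfolding generic_seq_def by blast
    qed
    from this[of i i' k k'] this[of i' i k' k] * show "i = i' \<and> k = k'" by auto
  qed
  define V where "V = ?f ` ?P"
  have V: "finite V" by (simp add: V_def)
  have cardV: "card {v\<in>V. y < v} = card {(i, k). i < n \<and> k \<in> {1..m} \<and> y < X i + real k}" for y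
  proof -
    have "{v\<in>V. y < v} = ?f ` {(i, k). i < n \<and> k \<in> {1..m} \<and> y < X i + real k}"
      by (force simp: V_def)
    moreover have "inj_on ?f {(i, k). i < n \<and> k \<in> {1..m} \<and> y < X i + real k}"
      by (rule inj_on_subset[OF inj]) auto
    ultimately show ?thesis by (simp add: card_image)
  qed
  have "\<exists>y. (\<forall>i<n. X i < y) \<and> y \<notin> V \<and> card {v\<in>V. y < v} = d"
  proof (cases n)
    case 0
    then show ?thesis using snoc.prems by (simp add: V_def height_path_append n_def)
  next
    case (Suc k)
    \<comment> \<open>Just above the last value \<open>X k\<close>, all \<open>m\<close> shifts of
      \<open>X k\<close> count in addition to \<open>above m X k\<close>; this is exactly the cap on
      the next height.\<close>
    have "{(i, c). i < n \<and> c \<in> {1..m} \<and> X k < X i + real c} = above m X k \<union> {k} \<times> {1..m}"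
      using Suc by (auto simp: above_def)
    moreover have "above m X k \<inter> {k} \<times> {1..m} = {}" by (auto simp: above_def)
    ultimately have "card {v\<in>V. X k < v} = card (above m X k) + m"
      unfolding cardV by (simp add: card_Un_disjoint finite_above)
    moreover have "last ds = card (above m X k)" "ds \<noteq> []"
      using D Suc by auto
    ultimately have "d \<le> card {v\<in>V. X k < v}"
      using snoc.prems by (simp add: height_path_append)
    then obtain y where y: "y > X k" "y \<notin> V" "card {v\<in>V. y < v} = d"
      using exists_point_with_card_above[OF V] by blast
    have "X i < y" if "i < n" for i
      using that y(1) X Suc by (force simp: generic_seq_def less_Suc_eq)
    then show ?thesis using y by blast
  qed
  then obtain y where y: "\<And>i. i < n \<Longrightarrow> X i < y" "y \<notin> V" "card {v\<in>V. y < v} = d" by blast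
  let ?X = "X(n := y)"
  have "y \<noteq> X i + real k" if "i < n" "k \<in> {1..m}" for i k
    using y(2) that unfolding V_def by force
  then have "generic_seq m (Suc n) ?X"
    using X y(1) by (auto simp: generic_seq_def less_Suc_eq)
  moreover have "card (above m ?X n) = d"
    using y(3) unfolding cardV by (simp add: above_def cong: conj_cong)
  moreover have "map (\<lambda>j. card (above m ?X j)) [0..<n] = ds"
    unfolding D[symmetric] by (auto intro!: arg_cong[of _ _ card] above_cong)
  ultimately show ?case by (intro exI[of _ ?X]) (simp add: n_def del: fun_upd_apply)
qed

section \<open>Regions in the dominant chamber\<close>

text \<open>Both images are in bijection with the classes of the common kernel; \<open>f x\<close>
  is sent to \<open>g x\<close>.\<close>

lemma card_image_eq_if_same_kernel:
  assumes "\<And>x y. x \<in> A \<Longrightarrow> y \<in> A \<Longrightarrow> f x = f y \<longleftrightarrow> g x = g y"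
  shows "card (f ` A) = card (g ` A)"
proof (rule bij_betw_same_card[of "\<lambda>u. g (inv_into A f u)"])
  have "g (inv_into A f (f x)) = g x" if "x \<in> A" for x
    using assms[of "inv_into A f (f x)" x] that by (simp add: f_inv_into_f inv_into_into)
  then show "bij_betw (\<lambda>u. g (inv_into A f u)) (f ` A) (g ` A)"
    using assms by (auto simp: bij_betw_def inj_on_def image_image)
qed

text \<open>Lower sets grow strictly with \<open>f\<close>, so the rank is injective into a set of
  size \<open>CARD('a)\<close> and therefore onto it.\<close>

lemma rank_bij:
  fixes f :: "'a::finite \<Rightarrow> 'b::linorder"
  assumes "inj f"
  defines "r \<equiv> \<lambda>i. card {k. f k < f i}"
  shows "r i < r j \<longleftrightarrow> f i < f j" and "bij_betw r UNIV {..<CARD('a)}"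
proof -
  have mono: "r i < r j" if "f i < f j" for i j
    unfolding r_def by (rule psubset_card_mono) (use that in auto)
  show iff: "r i < r j \<longleftrightarrow> f i < f j" for i j
    using mono[of i j] mono[of j i] by (cases "f i" "f j" rule: linorder_cases) (auto simp: r_def)
  have inj: "inj r"
    using iff assms(1) by (metis injI injD less_irrefl linorder_less_linear)
  have "r ` UNIV \<subseteq> {..<CARD('a)}"
    by (auto simp: r_def intro!: psubset_card_mono)
  moreover have "card (r ` UNIV) = CARD('a)" using inj by (simp add: card_image)
  ultimately have "r ` UNIV = {..<CARD('a)}" by (intro card_subset_eq) auto
  then show "bij_betw r UNIV {..<CARD('a)}" using inj by (simp add: bij_betw_def)
qed

lemma exists_decreasing_enum:
  "\<exists>e. bij_betw e {..<CARD('n)} (UNIV :: 'n::{finite,linorder} set) \<and>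
     (\<forall>i<CARD('n). \<forall>j<CARD('n). e i < e j \<longleftrightarrow> j < i)"
proof -
  define q where "q = (\<lambda>i::'n. card {k. k < i})"
  have q: "q i < q j \<longleftrightarrow> i < j" for i j
    using rank_bij(1)[of "\<lambda>i::'n. i" i j] by (simp add: q_def)
  \<comment> \<open>Negated integer ranks reverse the index order: in the dominant chamber
    coordinates increase as indices decrease.\<close>
  have "inj (\<lambda>i::'n. - int (q i))"
    using q by (metis (no_types, lifting) injI less_irrefl linorder_less_linear neg_equal_iff_equal of_nat_eq_iff)
  note r = rank_bij[OF this]
  define r where "r = (\<lambda>i::'n. card {k. - int (q k) < - int (q i)})"
  have r: "r i < r j \<longleftrightarrow> j < i" "bij_betw r UNIV {..<CARD('n)}" for i j
    using r q by (auto simp: r_def)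
  let ?e = "inv_into UNIV r"
  have "bij_betw ?e {..<CARD('n)} UNIV" using r(2) by (rule bij_betw_inv_into)
  moreover have "?e i < ?e j \<longleftrightarrow> j < i" if "i < CARD('n)" "j < CARD('n)" for i j
    using r(1)[of "?e j" "?e i"] that bij_betw_inv_into_right[OF r(2)] by simp
  ultimately show ?thesis by blast
qed

text \<open>Reading the coordinates in increasing order gives a generic sequence. Its heights
  \<open>L x\<close> determine the sign class and are determined by it, and the values of
  \<open>L\<close> on \<open>A\<close> are exactly the height sequences with \<open>l\<close>
  zeros.\<close>

lemma dominant_regions_height_paths:
  fixes m l :: nat
  assumes "m \<ge> 1"
  defines "A \<equiv> {x :: real^'n::{finite,linorder}. x \<notin> catalan_union m \<and> x \<in> dominant_chamber \<and>
             card (block_minima m x) = l}"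
  shows "card (sign_class m ` A) = card (height_paths m CARD('n) 0 l)"
proof -
  let ?n = "CARD('n)"
  obtain e :: "nat \<Rightarrow> 'n" where e: "bij_betw e {..<?n} UNIV"
      and ord: "\<And>i j. i < ?n \<Longrightarrow> j < ?n \<Longrightarrow> e i < e j \<longleftrightarrow> j < i"
    using exists_decreasing_enum by blast
  have inj: "e i = e j \<longleftrightarrow> i = j" if "i < ?n" "j < ?n" for i j
    using e that by (auto simp: bij_betw_def inj_on_def)
  have sur: "\<exists>i<?n. a = e i" for a
    using e by (auto simp: bij_betw_def)
  define X where "X = (\<lambda>(x::(real,'n) vec) i. x$(e i))"
  define L where "L = (\<lambda>x. map (\<lambda>j. card (above m (X x) j)) [0..<?n])"
  have gen_iff: "x \<notin> catalan_union m \<and> x \<in> dominant_chamber \<longleftrightarrow> generic_seq m ?n (X x)" for x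
  proof
    assume x: "x \<notin> catalan_union m \<and> x \<in> dominant_chamber"
    show "generic_seq m ?n (X x)" unfolding generic_seq_def
    proof (intro allI impI conjI ballI)
      fix i j assume ij: "j < ?n" "i < j"
      then show "X x i < X x j" using x ord[of j i] by (simp add: dominant_chamber_def X_def)
      fix k assume "k \<in> {1..m}"
      moreover have "e j \<noteq> e i" using inj ij by auto
      ultimately have "x$(e j) - x$(e i) \<noteq> real k"
        using x by (auto simp: notin_catalan_union_iff)
      then show "X x j \<noteq> X x i + real k" by (simp add: X_def)
    qed
  next
    assume g: "generic_seq m ?n (X x)"
    have lt: "x$(e i) < x$(e j)" if "i < j" "j < ?n" for i j
      using g that by (auto simp: generic_seq_def X_def)
    have "x \<in> dominant_chamber" unfolding dominant_chamber_def
    proof (intro CollectI allI impI)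
      fix a b :: 'n assume "a < b"
      then show "x$b < x$a" using sur[of a] sur[of b] ord lt by metis
    qed
    moreover have "x \<notin> catalan_union m" unfolding notin_catalan_union_iff
    proof (intro allI impI)
      fix a b :: 'n and k assume k: "k \<le> m" "a \<noteq> b"
      obtain i j where ij: "i < ?n" "j < ?n" "a = e i" "b = e j" using sur by metis
      show "x$a - x$b \<noteq> real k"
      proof (cases "j < i")
        case True
        then have "k \<in> {1..m} \<Longrightarrow> X x i \<noteq> X x j + real k" "X x j < X x i"
          using g ij by (auto simp: generic_seq_def)
        then show ?thesis using k ij by (cases "k = 0") (auto simp: X_def)
      next
        case False
        then have "i < j" using k ij by (metis linorder_neqE_nat)
        then show ?thesis using lt[of i j] ij by simp
      qed
    qed
    ultimately show "x \<notin> catalan_union m \<and> x \<in> dominant_chamber" by simp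
  qed
  have aboveI: "above m (X x) j = above m (X y) j"
    if "x \<notin> catalan_union m" "y \<in> sign_class m x" "j < ?n" for x y j
  proof -
    have *: "X x j < X x i + real k \<longleftrightarrow> X y j < X y i + real k" if "i < j" "k \<in> {1..m}" for i k
    proof -
      have "e j \<noteq> e i" using inj that \<open>j < ?n\<close> by auto
      then have "x$(e j) - x$(e i) \<noteq> real k" "y$(e j) - y$(e i) \<noteq> real k"
        using \<open>x \<notin> _\<close> \<open>y \<in> _\<close> that by (auto simp: notin_catalan_union_iff sign_class_def)
      moreover have "real k < x$(e j) - x$(e i) \<longleftrightarrow> real k < y$(e j) - y$(e i)"
        using sign_classD[OF \<open>y \<in> _\<close>] that by simp
      ultimately show ?thesis unfolding X_def by linarith
    qed
    then show ?thesis unfolding above_def by blast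
  qed
  have ker: "sign_class m x = sign_class m y \<longleftrightarrow> L x = L y" if "x \<in> A" "y \<in> A" for x y
  proof
    have x: "x \<notin> catalan_union m" "generic_seq m ?n (X x)" "x \<in> dominant_chamber"
      and y: "y \<notin> catalan_union m" "generic_seq m ?n (X y)" "y \<in> dominant_chamber"
      using that gen_iff by (auto simp: A_def)
    show "L x = L y" if "sign_class m x = sign_class m y"
    proof -
      have "y \<in> sign_class m x" using that sign_class_self[OF y(1)] by simp
      then show ?thesis unfolding L_def using aboveI[OF x(1)] by simp
    qed
    assume "L x = L y"
    then have "card (above m (X x) j) = card (above m (X y) j)" if "j < ?n" for j
      using that by (auto simp: L_def)
    then have ab: "above m (X x) j = above m (X y) j" if "j < ?n" for j
      using above_eq_if_card_eq[OF x(2) y(2)] that by blast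
    \<comment> \<open>For \<open>j < i\<close> and \<open>k > 0\<close> this is membership of
      \<open>(j, k)\<close> in the set at \<open>i\<close>, up to excluded equalities; for
      \<open>k = 0\<close> it is the common order. If \<open>j \<ge> i\<close>, neither difference
      is positive.\<close>
    have "real k < x$a - x$b \<longleftrightarrow> real k < y$a - y$b" if k: "k \<le> m" for a b k
    proof -
      obtain i j where ij: "i < ?n" "j < ?n" "a = e i" "b = e j" using sur by metis
      show ?thesis
      proof (cases "j < i")
        case True
        have lt: "X x j < X x i" "X y j < X y i" using True ij x y by (auto simp: generic_seq_def)
        show ?thesis
        proof (cases "k = 0")
          case True
          then show ?thesis using lt ij by (simp add: X_def)
        next
          case False
          then have k1: "k \<in> {1..m}" using k by simp
          have "(j, k) \<in> above m (X x) i \<longleftrightarrow> (j, k) \<in> above m (X y) i" using ab ij by simp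
          then have "X x i < X x j + real k \<longleftrightarrow> X y i < X y j + real k"
            using True k1 by (simp add: above_def)
          moreover have "X x i \<noteq> X x j + real k" "X y i \<noteq> X y j + real k"
            using x(2) y(2) True ij k1 unfolding generic_seq_def by blast+
          ultimately show ?thesis unfolding X_def ij by linarith
        qed
      next
        case False
        then have "X x i \<le> X x j" "X y i \<le> X y j" using ij x y
          by (cases "i = j"; auto simp: generic_seq_def less_imp_le)+
        then show ?thesis unfolding X_def ij by linarith
      qed
    qed
    then have "y \<in> sign_class m x" using y by (auto simp: sign_class_def)
    then show "sign_class m x = sign_class m y" using sign_class_eq by blast
  qed
  have zeros: "card (block_minima m x) = length (filter ((=) 0) (L x))"
    if g: "generic_seq m ?n (X x)" for x
  proof -
    have lt: "X x i < X x j \<longleftrightarrow> i < j" if "i < ?n" "j < ?n" for i j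
    proof -
      have "i < j \<Longrightarrow> X x i < X x j" "j < i \<Longrightarrow> X x j < X x i"
        using g that by (auto simp: generic_seq_def)
      then show ?thesis by (cases i j rule: linorder_cases) auto
    qed
    have "e j \<in> block_minima m x \<longleftrightarrow> card (above m (X x) j) = 0" if j: "j < ?n" for j
    proof -
      have "e j \<in> block_minima m x \<longleftrightarrow> (\<forall>i<j. real m < X x j - X x i)"
      proof
        assume "e j \<in> block_minima m x"
        then show "\<forall>i<j. real m < X x j - X x i"
          using lt j by (auto simp: block_minima_def X_def)
      next
        assume *: "\<forall>i<j. real m < X x j - X x i"
        show "e j \<in> block_minima m x" unfolding block_minima_def
        proof (intro CollectI allI impI)
          fix a assume a: "x$a < x$(e j)"
          obtain i where "i < ?n" "a = e i" using sur by blast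
          then show "real m < x$(e j) - x$a" using a * lt[of i j] j by (simp add: X_def)
        qed
      qed
      \<comment> \<open>The largest shift decides: if \<open>X i + m\<close> lies below
        \<open>X j\<close>, so do all smaller shifts. That \<open>m\<close> itself is an allowed
        shift uses \<open>m \<ge> 1\<close>.\<close>
      also have "\<dots> \<longleftrightarrow> above m (X x) j = {}"
      proof
        assume *: "\<forall>i<j. real m < X x j - X x i"
        show "above m (X x) j = {}"
        proof (rule ccontr)
          assume "above m (X x) j \<noteq> {}"
          then obtain i k where "i < j" "k \<le> m" "X x j < X x i + real k"
            by (auto simp: above_def)
          then show False using *[rule_format, of i] by simp
        qed
      next
        assume *: "above m (X x) j = {}"
        show "\<forall>i<j. real m < X x j - X x i"
        proof (intro allI impI)
          fix i assume "i < j"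
          have "(i, m) \<notin> above m (X x) j" using * by simp
          then have "\<not> X x j < X x i + real m"
            using \<open>i < j\<close> assms(1) by (simp add: above_def)
          moreover have "X x j \<noteq> X x i + real m"
            using g j \<open>i < j\<close> assms(1) by (auto simp: generic_seq_def)
          ultimately show "real m < X x j - X x i" by simp
        qed
      qed
      finally show ?thesis by (simp add: finite_above)
    qed
    then have "block_minima m x = e ` {j. j < ?n \<and> card (above m (X x) j) = 0}"
      using sur by (auto simp: image_iff) metis
    moreover have "inj_on e {j. j < ?n \<and> card (above m (X x) j) = 0}"
      using inj by (auto simp: inj_on_def)
    ultimately have "card (block_minima m x) = card {j. j < ?n \<and> card (above m (X x) j) = 0}"
      by (simp add: card_image)
    also have "\<dots> = length (filter ((=) 0) (L x))"
      unfolding length_filter_conv_card L_def by (intro arg_cong[of _ _ card]) auto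
    finally show ?thesis .
  qed
  have "L ` A = height_paths m ?n 0 l"
  proof
    show "L ` A \<subseteq> height_paths m ?n 0 l"
    proof
      fix ds assume "ds \<in> L ` A"
      then obtain x where x: "x \<in> A" "ds = L x" by auto
      then have g: "generic_seq m ?n (X x)" using gen_iff by (auto simp: A_def)
      then show "ds \<in> height_paths m ?n 0 l"
        using x zeros[OF g] height_path_of_seq[OF g] by (simp add: height_paths_def A_def L_def)
    qed
  next
    show "height_paths m ?n 0 l \<subseteq> L ` A"
    proof
      fix ds assume ds: "ds \<in> height_paths m ?n 0 l"
      then obtain Z where Z: "generic_seq m ?n Z" "map (\<lambda>j. card (above m Z j)) [0..<?n] = ds"
        using exists_seq_of_height_path[of m ds] by (auto simp: height_paths_def)
      \<comment> \<open>\<open>Z i\<close> becomes the coordinate with index \<open>e i\<close>, so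
        reading \<open>x\<close> through \<open>e\<close> returns \<open>Z\<close>.\<close>
      define x :: "(real,'n) vec" where "x = (\<chi> a. Z (inv_into {..<?n} e a))"
      have XZ: "X x i = Z i" if "i < ?n" for i
        using that e by (simp add: X_def x_def bij_betw_inv_into_left)
      have g: "generic_seq m ?n (X x)" using Z(1) XZ by (auto simp: generic_seq_def)
      have L: "L x = ds" unfolding L_def Z(2)[symmetric]
        by (auto intro!: arg_cong[of _ _ card] above_cong XZ)
      then have "x \<in> A" using gen_iff[of x] g zeros[OF g] ds by (simp add: A_def height_paths_def)
      then show "ds \<in> L ` A" using L by auto
    qed
  qed
  then show ?thesis using card_image_eq_if_same_kernel[of A "sign_class m" L] ker by simp
qed

section \<open>The action of the symmetric group\<close>

definition permute_coords :: "('n \<Rightarrow> 'n) \<Rightarrow> real^'n \<Rightarrow> real^'n" where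
  "permute_coords p x = (\<chi> i. x $ p i)"

lemma permute_coords_nth [simp]: "permute_coords p x $ i = x $ p i"
  by (simp add: permute_coords_def)

lemma permute_coords_inv:
  "bij p \<Longrightarrow> permute_coords p (permute_coords (inv p) x) = x"
  "bij p \<Longrightarrow> permute_coords (inv p) (permute_coords p x) = x"
  by (simp_all add: vec_eq_iff bij_is_inj bij_is_surj surj_f_inv_f)

lemma permute_coords_generic:
  fixes x :: "real^'n::{finite,linorder}"
  assumes "inj p" "x \<notin> catalan_union m"
  shows "permute_coords p x \<notin> catalan_union m"
  using assms by (simp add: notin_catalan_union_iff inj_eq)

text \<open>The defining conditions range over all ordered pairs of indices, so relabelling
  preserves them; the inverse permutation gives the other inclusion.\<close>

lemma permute_coords_sign_class:
  fixes x :: "real^'n::{finite,linorder}"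
  assumes p: "bij p"
  shows "permute_coords p ` sign_class m x = sign_class m (permute_coords p x)"
proof -
  have *: "permute_coords q y \<in> sign_class m (permute_coords q z)"
    if "bij q" "y \<in> sign_class m z" for q and y z :: "(real,'n) vec"
    using that permute_coords_generic[of q y m] by (auto simp: sign_class_def bij_is_inj)
  show ?thesis
  proof
    show "permute_coords p ` sign_class m x \<subseteq> sign_class m (permute_coords p x)"
      using *[OF p] by auto
    show "sign_class m (permute_coords p x) \<subseteq> permute_coords p ` sign_class m x"
    proof
      fix y assume "y \<in> sign_class m (permute_coords p x)"
      then have "permute_coords (inv p) y \<in> sign_class m x"
        using *[OF bij_imp_bij_inv[OF p]] permute_coords_inv(2)[OF p] by metis
      then show "y \<in> permute_coords p ` sign_class m x"
        using permute_coords_inv(1)[OF p] by (metis imageI)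
    qed
  qed
qed

lemma card_block_minima_permute_coords:
  assumes p: "bij p"
  shows "card (block_minima m (permute_coords p x)) = card (block_minima m x)"
proof -
  have "block_minima m x = p ` block_minima m (permute_coords p x)"
  proof
    show "p ` block_minima m (permute_coords p x) \<subseteq> block_minima m x"
      using bij_is_surj[OF p] by (auto simp: block_minima_def) (metis surjD)
    show "block_minima m x \<subseteq> p ` block_minima m (permute_coords p x)"
    proof
      fix j assume "j \<in> block_minima m x"
      moreover obtain i where "j = p i" using bij_is_surj[OF p] by (metis surjD)
      ultimately show "j \<in> p ` block_minima m (permute_coords p x)"
        by (auto simp: block_minima_def)
    qed
  qed
  then show ?thesis using card_image[OF inj_on_subset[OF bij_is_inj[OF p]]] by force
qed

text \<open>The value \<open>p i\<close> is determined by the number of indices \<open>j\<close>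
  with \<open>p j < p i\<close>, which is the same for \<open>q\<close>.\<close>

lemma order_determines_permutation:
  fixes p q :: "'n::{finite,linorder} \<Rightarrow> 'n"
  assumes "bij p" "bij q" and "\<And>i j. p i < p j \<longleftrightarrow> q i < q j"
  shows "p = q"
proof
  fix i
  have r: "card {k. k < f i} = card {j. f j < f i}" if "bij f" for f :: "'n \<Rightarrow> 'n"
  proof -
    have "{k. k < f i} = f ` {j. f j < f i}"
      using bij_is_surj[OF that] by (auto simp: image_iff)
    then show ?thesis using card_image[OF inj_on_subset[OF bij_is_inj[OF that]]] by force
  qed
  have "card {k. k < p i} = card {k. k < q i}" using r assms by simp
  then show "p i = q i"
    using rank_bij(1)[of "\<lambda>i::'n. i"] by (metis inj_on_id2 less_irrefl linorder_less_linear)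
qed

text \<open>The inverse appears so that \<open>x\<close> itself is \<open>permute_coords p\<close>
  of a dominant point.\<close>

lemma exists_sorting_permutation:
  fixes x :: "real^'n::{finite,linorder}"
  assumes "x \<notin> catalan_union m"
  shows "\<exists>p. bij p \<and> permute_coords (inv p) x \<in> dominant_chamber"
proof -
  have "inj (\<lambda>i. - x$i)" using notin_catalan_union_inj[OF assms] by (auto simp: inj_def)
  note h = rank_bij[OF this]
  define h where "h = (\<lambda>i. card {k. - x$k < - x$i})"
  have h: "h i < h j \<longleftrightarrow> x$j < x$i" "bij_betw h UNIV {..<CARD('n)}" for i j
    using h by (auto simp: h_def)
  define q where "q = (\<lambda>i::'n. card {k. k < i})"
  have q: "q i < q j \<longleftrightarrow> i < j" "bij_betw q UNIV {..<CARD('n)}" for i j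
    using rank_bij[of "\<lambda>i::'n. i"] by (auto simp: q_def)
  \<comment> \<open>The index of rank \<open>k\<close> is sent to the index whose coordinate has
    rank \<open>k\<close> from the top.\<close>
  define p where "p = inv_into UNIV h \<circ> q"
  have p: "bij p" unfolding p_def using bij_betw_trans[OF q(2) bij_betw_inv_into[OF h(2)]] by simp
  have hp: "h (p i) = q i" for i
    using bij_betw_inv_into_right[OF h(2)] q(2) by (auto simp: p_def bij_betw_def)
  have "permute_coords p x \<in> dominant_chamber"
    using h(1) hp q(1) by (simp add: dominant_chamber_def flip: h(1))
  then show ?thesis using p bij_imp_bij_inv inv_inv_eq by metis
qed

text \<open>Each region of the given level is the image of exactly one dominant region under exactly
  one permutation, and permuting preserves the number of blocks.\<close>

lemma card_regions_eq_fact_times_dominant: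
  fixes m l :: nat
  defines "G \<equiv> {x :: real^'n::{finite,linorder}. x \<notin> catalan_union m \<and> card (block_minima m x) = l}"
  shows "card (sign_class m ` G) =
    fact CARD('n) * card (sign_class m ` (G \<inter> dominant_chamber))"
proof -
  let ?P = "{p. p permutes (UNIV :: 'n set)}"
  let ?F = "\<lambda>(p, R). permute_coords p ` R"
  let ?D = "sign_class m ` (G \<inter> dominant_chamber)"
  have G: "permute_coords p x \<in> G" if "bij p" "x \<in> G" for p x
    using that permute_coords_generic[of p x m] card_block_minima_permute_coords[of p m x]
    by (simp add: G_def bij_is_inj)
  have "bij_betw ?F (?P \<times> ?D) (sign_class m ` G)"
    unfolding bij_betw_def
  proof
    show "inj_on ?F (?P \<times> ?D)"
    proof (rule inj_onI, clarsimp)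
      fix p q x y
      assume p: "p permutes (UNIV::'n set)" and q: "q permutes (UNIV::'n set)"
        and x: "x \<in> G" "x \<in> dominant_chamber" and y: "y \<in> G" "y \<in> dominant_chamber"
        and eq: "permute_coords p ` sign_class m x = permute_coords q ` sign_class m y"
      have pq: "bij p" "bij q" using p q by (auto intro: permutes_bij)
      have "permute_coords p x \<in> sign_class m (permute_coords p x)"
        using G[OF pq(1) x(1)] by (intro sign_class_self) (simp add: G_def)
      then have mem: "permute_coords p x \<in> sign_class m (permute_coords q y)"
        using eq pq by (simp add: permute_coords_sign_class)
      have dom: "z$a < z$b \<longleftrightarrow> b < a" if "z \<in> dominant_chamber" for z :: "(real,'n) vec" and a b
      proof -
        have "b < a \<Longrightarrow> z$a < z$b" "a < b \<Longrightarrow> z$b < z$a"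
          using that by (auto simp: dominant_chamber_def)
        then show ?thesis by (cases a b rule: linorder_cases) auto
      qed
      \<comment> \<open>Dominant points are ordered oppositely to their indices, so the common
        coordinate order of the image region recovers the permutation.\<close>
      have "p = q"
        using sign_class_order[OF mem] dom[OF x(2)] dom[OF y(2)]
        by (intro order_determines_permutation pq) simp
      moreover have "inj (permute_coords p)"
        using permute_coords_inv(2)[OF pq(1)] by (metis injI)
      ultimately show "p = q \<and> sign_class m x = sign_class m y"
        using eq by (simp add: inj_image_eq_iff)
    qed
  next
    show "?F ` (?P \<times> ?D) = sign_class m ` G"
    proof
      show "?F ` (?P \<times> ?D) \<subseteq> sign_class m ` G"
        using G by (auto simp: permute_coords_sign_class permutes_bij)
      show "sign_class m ` G \<subseteq> ?F ` (?P \<times> ?D)"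
      proof clarify
        fix x assume x: "x \<in> G"
        then obtain p where p: "bij p" "permute_coords (inv p) x \<in> dominant_chamber"
          using exists_sorting_permutation[of x m] by (auto simp: G_def)
        have "permute_coords (inv p) x \<in> G \<inter> dominant_chamber"
          using G[OF bij_imp_bij_inv[OF p(1)] x] p by simp
        moreover have "sign_class m x = permute_coords p ` sign_class m (permute_coords (inv p) x)"
          using p by (simp add: permute_coords_sign_class permute_coords_inv)
        moreover have "p permutes UNIV" using p by (auto intro: bij_imp_permutes)
        ultimately show "sign_class m x \<in> ?F ` (?P \<times> ?D)"
          by (intro image_eqI[of _ _ "(p, sign_class m (permute_coords (inv p) x))"]) auto
      qed
    qed
  qed
  then have "card (?P \<times> ?D) = card (sign_class m ` G)" by (rule bij_betw_same_card)
  then show ?thesis by (simp add: card_cartesian_product card_permutations)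
qed

section \<open>From sign classes to the counting formula\<close>

lemma sign_class_subset_dominant_iff:
  assumes "x \<notin> catalan_union m"
  shows "sign_class m x \<subseteq> dominant_chamber \<longleftrightarrow> x \<in> dominant_chamber"
  using sign_class_self[OF assms] sign_class_order
  unfolding dominant_chamber_def by blast

theorem theorem5p1:
  fixes m n l :: nat
  assumes "m \<ge> 1" and "n = CARD('n)" and "1 \<le> l" and "l \<le> n"
  shows "real (card {R \<in> (catalan_regions m :: (real^('n::{finite,linorder})) set set).
              level R = l \<and> R \<subseteq> dominant_chamber})
           = real (m * l) / real ((m + 1) * n - l) * real (((m + 1) * n - l) choose (m * n))
       \<and> card {R \<in> (catalan_regions m :: (real^('n::{finite,linorder})) set set). level R = l}
           = fact n * card {R \<in> (catalan_regions m :: (real^('n::{finite,linorder})) set set).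
              level R = l \<and> R \<subseteq> dominant_chamber}"
proof -
  let ?G = "{x :: (real,'n) vec. x \<notin> catalan_union m \<and> card (block_minima m x) = l}"
  \<comment> \<open>Writing \<open>n = l + c\<close> removes the truncated subtractions from the
    identities below.\<close>
  obtain c where c: "n = l + c" using assms(4) le_Suc_ex by blast
  have all: "{R \<in> (catalan_regions m :: (real,'n) vec set set). level R = l} = sign_class m ` ?G"
    unfolding catalan_regions_eq by (auto simp: level_sign_class)
  \<comment> \<open>Dominance consists of comparisons with threshold 0, so a region containing one
    dominant point lies in the chamber.\<close>
  have dom: "{R \<in> (catalan_regions m :: (real,'n) vec set set). level R = l \<and> R \<subseteq> dominant_chamber}
      = sign_class m ` (?G \<inter> dominant_chamber)"
    unfolding catalan_regions_eq
    by (auto simp: level_sign_class dest: sign_class_subset_dominant_iff[THEN iffD1, rotated]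
        sign_class_subset_dominant_iff[THEN iffD2, rotated])
  have eq: "?G \<inter> dominant_chamber =
      {x. x \<notin> catalan_union m \<and> x \<in> dominant_chamber \<and> card (block_minima m x) = l}"
    by auto
  \<comment> \<open>Cap 0 and \<open>l\<close> zeros give the Raney parameter
    \<open>0 + m * l\<close>, with \<open>n - l\<close> nonzero entries left. The closed form below
    needs this parameter positive.\<close>
  have "int (card (sign_class m ` (?G \<inter> dominant_chamber))) = raney m (m * l) (n - l)"
    unfolding eq dominant_regions_height_paths[OF assms(1)] card_height_paths
    using assms by simp
  from arg_cong[OF this, of real_of_int]
  have "real (card (sign_class m ` (?G \<inter> dominant_chamber))) = real_of_int (raney m (m * l) (n - l))"
    unfolding of_int_of_nat_eq .
  also have "\<dots> = real (m * l) / real ((m + 1) * (n - l) + m * l) *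
      real (((m + 1) * (n - l) + m * l) choose (n - l))"
    using assms by (intro raney_closed_form) simp
  also have "(m + 1) * (n - l) + m * l = (m + 1) * n - l"
    unfolding c by (simp add: algebra_simps)
  also have "((m + 1) * n - l) choose (n - l) = ((m + 1) * n - l) choose (m * n)"
  proof -
    have "(m + 1) * n - l - (n - l) = m * n" "n - l \<le> (m + 1) * n - l"
      unfolding c by (simp_all add: algebra_simps)
    then show ?thesis using binomial_symmetric[of "n - l" "(m + 1) * n - l"] by simp
  qed
  finally show ?thesis
    unfolding all dom card_regions_eq_fact_times_dominant assms(2) by simp
qed

end
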